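(* Let $(\mathcal{L},\mathcal{H},(\cdot,\cdot))$ be an extended affine Lie superalgebra with root system $R=R_0\cup R_1$. For $\alpha,\beta\in R$ with $(\alpha,\alpha)\neq0$, the following hold. (i) $\frac{2(\beta,\alpha)}{(\alpha,\alpha)}\in\mathbb{Z}$; in particular, if $k\in\mathbb{F}$ and $k\alpha\in R$, then $k\in\{0,\pm1,\pm2,\pm1/2\}$. (ii) $r_\alpha(\beta):=\beta-\frac{2(\alpha,\beta)}{(\alpha,\alpha)}\alpha\in R$. (iii) There are nonnegative integers $p,q$ such that $p-q=2(\beta,\alpha)/(\alpha,\alpha)$ and $\{k\in\mathbb{Z}\mid\beta+k\alpha\in R\}=\{-p,\ldots,q\}$.
   Context: All vector spaces are over a field $\mathbb{F}$ of characteristic zero. A super-toral triple $(\mathcal{L},\mathcal{H},(\cdot,\cdot))$ consists of a nonzero Lie superalgebra $\mathcal{L}=\mathcal{L}_{\bar 0}\oplus\mathcal{L}_{\bar 1}$, a nontrivial (nonzero) subalgebra $\mathcal{H}$ of $\mathcal{L}_{\bar 0}$ and a nondegenerate invariant even supersymmetric bilinear form $(\cdot,\cdot)$ on $\mathcal{L}$ such that: $\mathcal{L}$ has a weight space decomposition $\mathcal{L}=\bigoplus_{\alpha\in\mathcal{H}^*}\mathcal{L}^\alpha$ with respect to $\mathcal{H}$ via the adjoint representation, where $\mathcal{L}^\alpha=\{x\in\mathcal{L}\mid [h,x]=\alpha(h)x\ \forall h\in\mathcal{H}\}$; and the restriction of the form to $\mathcal{H}$ is nondegenerate. Then $\mathcal{H}$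 is abelian and, for $i\in\{0,1\}$, $\mathcal{L}_{\bar i}=\bigoplus_\alpha\mathcal{L}_{\bar i}^\alpha$ with $\mathcal{L}_{\bar i}^\alpha:=\mathcal{L}_{\bar i}\cap\mathcal{L}^\alpha$. Put $R:=\{\alpha\in\mathcal{H}^*\mid\mathcal{L}^\alpha\neq\{0\}\}$ (the root system) and $R_i:=\{\alpha\in\mathcal{H}^*\mid\mathcal{L}_{\bar i}^\alpha\neq\{0\}\}$ for $i=0,1$, so $R=R_0\cup R_1$. Let $\mathfrak{p}:\mathcal{H}\to\mathcal{H}^*$, $h\mapsto(h,\cdot)$, which is injective, and let $\mathcal{H}^{\mathfrak{p}}$ be its image. For $\alpha\in\mathcal{H}^{\mathfrak{p}}$ let $t_\alpha\in\mathcal{H}$ be the unique element with $\alpha=(t_\alpha,\cdot)$ on $\mathcal{H}$, and set $(\alpha,\beta):=(t_\alpha,t_\beta)$ for $\alpha,\beta\in\mathcal{H}^{\mathfrak{p}}$. A super-toral triple is an extended affine Lie superalgebra if (1) for $i\in\{0,1\}$ and $\alpha\in R_i\setminus\{0\}$ there are $x_\alpha\in\mathcal{L}_{\bar i}^\alpha$ and $x_{-\alpha}\in\mathcal{L}_{\bar i}^{-\alpha}$ with $0\neq[x_\alpha,x_{-\alpha}]\in\mathcal{H}$ (this implies $R\subseteq\mathcal{H}^{\mathfrak{p}}$, so that $(\alpha,\beta)$ is defined for roots), and (2) for $\alpha\in R$ with $(\alpha,\alpha)\neq0$ and $x\in\mathcal{L}^\alpha$, the map $\mathrm{ad}_x:\mathcal{L}\to\mathcal{L}$,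 $y\mapsto[x,y]$, is locally nilpotent. *)

theory Defs
  imports Complex_Main "HOL-Library.Z2"
begin

text \<open>
  The superalgebra is the whole type \<open>'v\<close>, made into a vector space by \<open>scale\<close>; its parity
  components are indexed by the two-element field \<open>bit\<close>, so that parities add modulo 2.
\<close>

definition is_direct_sum ::
  "('f::field \<Rightarrow> 'v::ab_group_add \<Rightarrow> 'v) \<Rightarrow> 'i set \<Rightarrow> ('i \<Rightarrow> 'v set) \<Rightarrow> bool" where
  "is_direct_sum scale I W \<longleftrightarrow>
     (\<forall>i\<in>I. module.subspace scale (W i)) \<and>
     (\<forall>x. \<exists>!f. (\<forall>i\<in>I. f i \<in> W i) \<and> (\<forall>i. i \<notin> I \<longrightarrow> f i = 0) \<and>
        finite {i. f i \<noteq> 0} \<and> x = (\<Sum>i | f i \<noteq> 0. f i))"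

text \<open>The sign \<open>(-1)\<close> to the power \<open>i j\<close>.\<close>

definition super_sign :: "bit \<Rightarrow> bit \<Rightarrow> 'f::field" where
  "super_sign i j = (if i = 1 \<and> j = 1 then -1 else 1)"

locale lie_superalgebra = vector_space scale
  for scale :: "'f::field_char_0 \<Rightarrow> 'v::ab_group_add \<Rightarrow> 'v" +
  fixes bracket :: "'v \<Rightarrow> 'v \<Rightarrow> 'v"
    and L :: "bit \<Rightarrow> 'v set"
  assumes grading: "is_direct_sum scale UNIV L"
    and bracket_linear_left: "Vector_Spaces.linear scale scale (\<lambda>x. bracket x y)"
    and bracket_linear_right: "Vector_Spaces.linear scale scale (\<lambda>y. bracket x y)"
    and bracket_grading: "x \<in> L i \<Longrightarrow> y \<in> L j \<Longrightarrow> bracket x y \<in> L (i + j)"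
    and super_skew: "x \<in> L i \<Longrightarrow> y \<in> L j \<Longrightarrow>
      bracket x y = - scale (super_sign i j) (bracket y x)"
    and super_jacobi: "x \<in> L i \<Longrightarrow> y \<in> L j \<Longrightarrow>
      bracket x (bracket y z) =
        bracket (bracket x y) z + scale (super_sign i j) (bracket y (bracket x z))"

text \<open>
  A functional on \<open>H\<close> is represented by the function on \<open>'v\<close> extending it by \<open>0\<close> outside \<open>H\<close>.
  This makes equality of functionals equality of functions, and sums and multiples of functionals
  can be formed pointwise.
\<close>

definition dual_space ::
  "('f::field \<Rightarrow> 'v::ab_group_add \<Rightarrow> 'v) \<Rightarrow> 'v set \<Rightarrow> ('v \<Rightarrow> 'f) set" where
  "dual_space scale H = {\<alpha>.
     (\<forall>x\<in>H. \<forall>y\<in>H. \<alpha> (x + y) = \<alpha> x + \<alpha> y) \<and>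
     (\<forall>c. \<forall>x\<in>H. \<alpha> (scale c x) = c * \<alpha> x) \<and>
     (\<forall>x. x \<notin> H \<longrightarrow> \<alpha> x = 0)}"

definition weight_space ::
  "('f \<Rightarrow> 'v \<Rightarrow> 'v) \<Rightarrow> ('v \<Rightarrow> 'v \<Rightarrow> 'v) \<Rightarrow> 'v set \<Rightarrow> ('v \<Rightarrow> 'f) \<Rightarrow> 'v set" where
  "weight_space scale bracket H \<alpha> = {x. \<forall>h\<in>H. bracket h x = scale (\<alpha> h) x}"

definition root_system ::
  "('f::field \<Rightarrow> 'v::ab_group_add \<Rightarrow> 'v) \<Rightarrow> ('v \<Rightarrow> 'v \<Rightarrow> 'v) \<Rightarrow> 'v set \<Rightarrow> ('v \<Rightarrow> 'f) set" where
  "root_system scale bracket H =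
     {\<alpha> \<in> dual_space scale H. weight_space scale bracket H \<alpha> \<noteq> {0}}"

definition graded_root_system ::
  "('f::field \<Rightarrow> 'v::ab_group_add \<Rightarrow> 'v) \<Rightarrow> ('v \<Rightarrow> 'v \<Rightarrow> 'v) \<Rightarrow> (bit \<Rightarrow> 'v set) \<Rightarrow> 'v set \<Rightarrow>
     bit \<Rightarrow> ('v \<Rightarrow> 'f) set" where
  "graded_root_system scale bracket L H i =
     {\<alpha> \<in> dual_space scale H. L i \<inter> weight_space scale bracket H \<alpha> \<noteq> {0}}"

text \<open>
  \<open>dual_map\<close> sends \<open>h \<in> H\<close> to the functional \<open>(h, _)\<close> on \<open>H\<close>. The element \<open>dual_rep H form \<alpha>\<close>
  (usually written \<open>t\<close> with index \<open>\<alpha>\<close>) and the values of \<open>dual_form\<close> are meaningful only for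
  functionals in the image of \<open>H\<close> under \<open>dual_map\<close>.
\<close>

definition dual_map :: "'v set \<Rightarrow> ('v \<Rightarrow> 'v \<Rightarrow> 'f::field) \<Rightarrow> 'v \<Rightarrow> 'v \<Rightarrow> 'f" where
  "dual_map H form h = (\<lambda>x. if x \<in> H then form h x else 0)"

definition dual_rep :: "'v set \<Rightarrow> ('v \<Rightarrow> 'v \<Rightarrow> 'f::field) \<Rightarrow> ('v \<Rightarrow> 'f) \<Rightarrow> 'v" where
  "dual_rep H form \<alpha> = (THE t. t \<in> H \<and> \<alpha> = dual_map H form t)"

definition dual_form ::
  "'v set \<Rightarrow> ('v \<Rightarrow> 'v \<Rightarrow> 'f::field) \<Rightarrow> ('v \<Rightarrow> 'f) \<Rightarrow> ('v \<Rightarrow> 'f) \<Rightarrow> 'f" where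
  "dual_form H form \<alpha> \<beta> = form (dual_rep H form \<alpha>) (dual_rep H form \<beta>)"

definition root_reflection ::
  "'v set \<Rightarrow> ('v \<Rightarrow> 'v \<Rightarrow> 'f::field) \<Rightarrow> ('v \<Rightarrow> 'f) \<Rightarrow> ('v \<Rightarrow> 'f) \<Rightarrow> 'v \<Rightarrow> 'f" where
  "root_reflection H form \<alpha> \<beta> =
     (\<lambda>h. \<beta> h - 2 * dual_form H form \<alpha> \<beta> / dual_form H form \<alpha> \<alpha> * \<alpha> h)"

locale super_toral_triple = lie_superalgebra scale bracket L
  for scale :: "'f::field_char_0 \<Rightarrow> 'v::ab_group_add \<Rightarrow> 'v"
    and bracket :: "'v \<Rightarrow> 'v \<Rightarrow> 'v"
    and L :: "bit \<Rightarrow> 'v set" +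
  fixes H :: "'v set"
    and form :: "'v \<Rightarrow> 'v \<Rightarrow> 'f"
  assumes nonzero: "(UNIV :: 'v set) \<noteq> {0}"
    and H_subspace: "subspace H"
    and H_even: "H \<subseteq> L 0"
    and H_closed: "x \<in> H \<Longrightarrow> y \<in> H \<Longrightarrow> bracket x y \<in> H"
    and H_nonzero: "H \<noteq> {0}"
    and form_linear_left: "Vector_Spaces.linear scale (*) (\<lambda>x. form x y)"
    and form_linear_right: "Vector_Spaces.linear scale (*) (\<lambda>y. form x y)"
    and form_even: "x \<in> L i \<Longrightarrow> y \<in> L j \<Longrightarrow> i \<noteq> j \<Longrightarrow> form x y = 0"
    and form_supersymmetric: "x \<in> L i \<Longrightarrow> y \<in> L j \<Longrightarrow> form x y = super_sign i j * form y x"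
    and form_invariant: "form (bracket x y) z = form x (bracket y z)"
    and form_nondegenerate: "(\<And>y. form x y = 0) \<Longrightarrow> x = 0"
    and weight_decomposition:
      "is_direct_sum scale (dual_space scale H) (weight_space scale bracket H)"
    and form_nondegenerate_H: "h \<in> H \<Longrightarrow> (\<And>h'. h' \<in> H \<Longrightarrow> form h h' = 0) \<Longrightarrow> h = 0"

locale extended_affine_lie_superalgebra = super_toral_triple scale bracket L H form
  for scale :: "'f::field_char_0 \<Rightarrow> 'v::ab_group_add \<Rightarrow> 'v"
    and bracket :: "'v \<Rightarrow> 'v \<Rightarrow> 'v"
    and L :: "bit \<Rightarrow> 'v set"
    and H :: "'v set"
    and form :: "'v \<Rightarrow> 'v \<Rightarrow> 'f" +
  assumes root_pair:
    "\<alpha> \<in> graded_root_system scale bracket L H i \<Longrightarrow> \<alpha> \<noteq> (\<lambda>_. 0) \<Longrightarrow>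
       \<exists>x \<in> L i \<inter> weight_space scale bracket H \<alpha>.
       \<exists>y \<in> L i \<inter> weight_space scale bracket H (\<lambda>h. - \<alpha> h).
         bracket x y \<noteq> 0 \<and> bracket x y \<in> H"
    and ad_locally_nilpotent:
      "\<alpha> \<in> root_system scale bracket H \<Longrightarrow> dual_form H form \<alpha> \<alpha> \<noteq> 0 \<Longrightarrow>
       x \<in> weight_space scale bracket H \<alpha> \<Longrightarrow> \<exists>n. (bracket x ^^ n) y = 0"

end

theory Submission
  imports Defs
begin

text \<open>
  A nonisotropic root \<open>\<alpha>\<close> yields an sl2-triple with locally nilpotent \<open>e\<close> and \<open>f\<close>, for \<open>\<alpha>\<close> itself if
  it is even and for \<open>2\<alpha>\<close> if it is odd. Highest weight vectors then give integrality and the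
  reflection, and injectivity of \<open>f\<close> on positive weight spaces lets one step from \<open>\<beta>\<close> to \<open>\<beta> - \<alpha>\<close>
  whenever \<open>(\<beta>, \<alpha>) / (\<alpha>, \<alpha>) > 0\<close>. Local nilpotency alone does not bound root strings; boundedness
  comes from integrality applied to the nonisotropic members of the string themselves. A bounded
  string that is closed under reflection and under steps towards its centre is an interval.
\<close>

section \<open>Two facts about sets of integers\<close>

text \<open>The quotient has a linear numerator and a quadratic denominator, so for large
  \<open>n\<close> it would lie strictly between 0 and 1. The field carries no order; hence
  \<open>b\<close> is first shown to be rational, and the comparison is made between integers after
  clearing denominators.\<close>

lemma integral_quotients_bounded:
  fixes b :: "'f::field_char_0" and A :: int and S :: "int set"
  assumes quot: "\<And>n. n \<in> S \<Longrightarrow> b + of_int (n * A + n ^ 2) \<noteq> 0 \<Longrightarrow>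
      \<exists>m::int. of_int m * (b + of_int (n * A + n ^ 2)) = of_int (A + 2 * n)"
  shows "\<exists>u. \<forall>n\<in>S. n \<le> u"
proof (rule ccontr)
  assume "\<not> ?thesis"
  then have unbounded: "\<exists>n\<in>S. n > u" for u
    by (meson not_le)
  obtain n\<^sub>0 where n\<^sub>0: "n\<^sub>0 \<in> S" "n\<^sub>0 > \<bar>A\<bar>"
    using unbounded by blast
  \<comment> \<open>Either the denominator at \<open>n\<^sub>0\<close> vanishes, or the quotient
    there is a nonzero integer because \<open>n\<^sub>0 > \<bar>A\<bar>\<close> keeps the numerator
    nonzero. Both cases express \<open>b\<close> as a fraction.\<close>
  have "\<exists>m B::int. m \<noteq> 0 \<and> of_int m * b = of_int B"
  proof (cases "b + of_int (n\<^sub>0 * A + n\<^sub>0 ^ 2) = 0")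
    case True
    then have "of_int 1 * b = of_int (- (n\<^sub>0 * A + n\<^sub>0 ^ 2))"
      by (simp only: of_int_1 mult_1_left of_int_minus eq_neg_iff_add_eq_0)
    then show ?thesis
      by (metis one_neq_zero)
  next
    case False
    then obtain m :: int where m: "of_int m * (b + of_int (n\<^sub>0 * A + n\<^sub>0 ^ 2)) = of_int (A + 2 * n\<^sub>0)"
      using quot n\<^sub>0 by blast
    have "A + 2 * n\<^sub>0 \<noteq> 0"
      using n\<^sub>0 by linarith
    then have "m \<noteq> 0"
      using m by (metis mult_zero_left of_int_0 of_int_eq_0_iff)
    moreover have "of_int m * b = of_int (A + 2 * n\<^sub>0 - m * (n\<^sub>0 * A + n\<^sub>0 ^ 2))"
      using m by (simp only: of_int_diff[of "A + 2 * n\<^sub>0"] of_int_mult[of m] distrib_left[of "of_int m"] eq_diff_eq)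
    ultimately show ?thesis
      by blast
  qed
  then obtain m' B' :: int where "m' \<noteq> 0" "of_int m' * b = of_int B'"
    by blast
  then have "\<bar>m'\<bar> > 0 \<and> of_int \<bar>m'\<bar> * b = of_int (if m' > 0 then B' else - B')"
    by (auto simp: abs_if)
  then obtain m B :: int where mB: "m > 0" "of_int m * b = of_int B"
    by blast
  \<comment> \<open>This size makes \<open>Q\<close> exceed \<open>A + 2 * n\<close> by more than
    \<open>\<bar>B\<bar>\<close>, which absorbs the unknown sign of \<open>B\<close>.\<close>
  obtain n where n: "n \<in> S" "n > 2 * \<bar>A\<bar> + \<bar>B\<bar> + 2"
    using unbounded by blast
  define Q where "Q = n * A + n ^ 2"
  have eq: "of_int m * (b + of_int Q) = of_int (B + m * Q)"
    using mB by (simp add: distrib_left)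
  have "n * 1 \<le> n * (n + A - 2)"
    using n by (intro mult_left_mono) linarith+
  then have "Q - (A + 2 * n) \<ge> \<bar>B\<bar> + 1"
    using n unfolding Q_def by (simp add: power2_eq_square algebra_simps)
  then have "m * (Q - (A + 2 * n)) \<ge> 1 * (\<bar>B\<bar> + 1)"
    using mB by (intro mult_mono) auto
  then have big: "B + m * Q > m * (A + 2 * n)"
    by (simp add: algebra_simps)
  have pos: "m * (A + 2 * n) > 0"
    using mB n by (intro mult_pos_pos) linarith+
  have "of_int (B + m * Q) \<noteq> (0::'f)"
    using big pos by (simp only: of_int_eq_0_iff)
  then have "b + of_int Q \<noteq> 0"
    using eq by auto
  then obtain k :: int where k: "of_int k * (b + of_int Q) = of_int (A + 2 * n)"
    using quot n unfolding Q_def by blast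
  have "of_int (k * (B + m * Q)) = of_int k * (of_int m * (b + of_int Q))"
    by (simp only: of_int_mult eq)
  also have "\<dots> = of_int m * (of_int k * (b + of_int Q))"
    by (simp only: mult.left_commute)
  also have "\<dots> = of_int (m * (A + 2 * n))"
    by (simp only: k of_int_mult)
  finally have k': "k * (B + m * Q) = m * (A + 2 * n)"
    by (simp only: of_int_eq_iff)
  with big pos have "k > 0"
    by (metis less_trans zero_less_mult_pos2)
  then have "1 * (B + m * Q) \<le> k * (B + m * Q)"
    using big pos by (intro mult_right_mono) linarith+
  then show False
    using k' big by simp
qed

text \<open>The reflection has centre \<open>- n / 2\<close>. Steps towards the centre fill the half
  to its right, starting from the maximum, and reflection carries that half to the other one. In the
  application \<open>n\<close> is the Cartan integer of \<beta> with respect to \<alpha>.\<close>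

lemma symmetric_string_eq_interval:
  fixes S :: "int set" and n :: int
  assumes "0 \<in> S"
    and bound: "\<And>k. k \<in> S \<Longrightarrow> k \<le> u"
    and reflect: "\<And>k. k \<in> S \<Longrightarrow> - n - k \<in> S"
    and step: "\<And>k. k \<in> S \<Longrightarrow> n + 2 * k > 0 \<Longrightarrow> k - 1 \<in> S"
  shows "\<exists>p q::nat. int p - int q = n \<and> S = {- int p..int q}"
proof -
  have "S \<subseteq> {- n - u..u}"
    using bound reflect by force
  then have "finite S"
    by (rule finite_subset) simp
  define q where "q = Max S"
  have q: "q \<in> S" "\<And>k. k \<in> S \<Longrightarrow> k \<le> q"
    unfolding q_def using \<open>finite S\<close> \<open>0 \<in> S\<close> by (auto intro: Max_in)
  \<comment> \<open>Downward induction from the maximum: if \<open>j - 1\<close> is not left of the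
    centre, then \<open>n + 2 * j > 0\<close>, so the step from \<open>j\<close> is
    available.\<close>
  have descend: "j \<le> q \<Longrightarrow> n + 2 * j \<ge> 0 \<longrightarrow> j \<in> S" for j
  proof (induction j rule: int_le_induct)
    case base
    show ?case using q by simp
  next
    case (step j)
    then show ?case using assms(4)[of j] by auto
  qed
  have "S = {- n - q..q}"
  proof (intro equalityI subsetI)
    fix k assume "k \<in> S"
    then show "k \<in> {- n - q..q}"
      using q(2)[OF \<open>k \<in> S\<close>] q(2)[OF reflect[OF \<open>k \<in> S\<close>]] by simp
  next
    fix k assume k: "k \<in> {- n - q..q}"
    show "k \<in> S"
    proof (cases "n + 2 * k \<ge> 0")
      case True
      then show ?thesis using descend k by simp
    next
      case False
      then have "- n - k \<in> S" using descend[of "- n - k"] k by simp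
      then show ?thesis using reflect[of "- n - k"] by simp
    qed
  qed
  \<comment> \<open>Both \<open>0\<close> and its mirror image \<open>- n\<close> are at most the
    maximum, so \<open>nat\<close> does not alter the witnesses \<open>n + q\<close> and
    \<open>q\<close>.\<close>
  moreover have "q \<ge> 0" "n + q \<ge> 0"
    using q \<open>0 \<in> S\<close> q(2)[OF reflect[OF \<open>0 \<in> S\<close>]] by auto
  ultimately show ?thesis
    by (intro exI[of _ "nat (n + q)"] exI[of _ "nat q"]) auto
qed

section \<open>Calculus of the super bracket\<close>

context lie_superalgebra
begin

lemma bracket_simps [simp]:
  "bracket (x + x') y = bracket x y + bracket x' y"
  "bracket y (x + x') = bracket y x + bracket y x'"
  "bracket (scale c x) y = scale c (bracket x y)"
  "bracket y (scale c x) = scale c (bracket y x)"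
  "bracket (- x) y = - bracket x y"
  "bracket y (- x) = - bracket y x"
  "bracket 0 y = 0"
  "bracket y 0 = 0"
proof -
  interpret l: Vector_Spaces.linear scale scale "\<lambda>x. bracket x y"
    by (rule bracket_linear_left)
  interpret r: Vector_Spaces.linear scale scale "\<lambda>x. bracket y x"
    by (rule bracket_linear_right)
  show "bracket (x + x') y = bracket x y + bracket x' y"
    "bracket y (x + x') = bracket y x + bracket y x'"
    "bracket (scale c x) y = scale c (bracket x y)"
    "bracket y (scale c x) = scale c (bracket y x)"
    "bracket (- x) y = - bracket x y"
    "bracket y (- x) = - bracket y x"
    "bracket 0 y = 0"
    "bracket y 0 = 0"
    by (fact l.add r.add l.scale r.scale l.neg r.neg l.zero r.zero)+
qed

lemma subspace_parity: "subspace (L i)"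
  using grading unfolding is_direct_sum_def by simp

lemma UNIV_bit: "(UNIV :: bit set) = {0, 1}"
  by (auto intro: bit.exhaust)

lemma sum_support_bit:
  fixes g :: "bit \<Rightarrow> 'v"
  shows "(\<Sum>i | g i \<noteq> 0. g i) = g 0 + g 1"
proof -
  have "(\<Sum>i | g i \<noteq> 0. g i) = (\<Sum>i\<in>UNIV. g i)"
    by (rule sum.mono_neutral_left) (auto simp: UNIV_bit)
  then show ?thesis by (simp add: UNIV_bit)
qed

lemma parity_decomposition:
  obtains a b where "a \<in> L 0" "b \<in> L 1" "x = a + b"
proof -
  obtain g where "\<forall>i. g i \<in> L i" "x = (\<Sum>i | g i \<noteq> 0. g i)"
    using grading unfolding is_direct_sum_def by blast
  then show ?thesis
    using that[of "g 0" "g 1"] by (simp add: sum_support_bit)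
qed

lemma parity_decomposition_unique:
  assumes "a \<in> L 0" "b \<in> L 1" "a' \<in> L 0" "b' \<in> L 1" "a + b = a' + b'"
  shows "a = a' \<and> b = b'"
proof -
  define g where "g = (\<lambda>i::bit. if i = 0 then a else b)"
  define g' where "g' = (\<lambda>i::bit. if i = 0 then a' else b')"
  have in_L: "\<forall>i. g i \<in> L i" "\<forall>i. g' i \<in> L i"
    unfolding g_def g'_def using assms by auto
  have "a + b = (\<Sum>i | g i \<noteq> 0. g i)" "a + b = (\<Sum>i | g' i \<noteq> 0. g' i)"
    using assms unfolding sum_support_bit by (simp_all add: g_def g'_def)
  moreover have "finite {i. g i \<noteq> 0}" "finite {i. g' i \<noteq> 0}"
    by (rule finite_subset[OF subset_UNIV]; simp add: UNIV_bit)+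
  moreover have "\<exists>!g. (\<forall>i. g i \<in> L i) \<and> finite {i. g i \<noteq> 0} \<and> a + b = (\<Sum>i | g i \<noteq> 0. g i)"
    using grading unfolding is_direct_sum_def by simp
  ultimately have "g = g'"
    using in_L by blast
  then have "g 0 = g' 0" "g 1 = g' 1"
    by simp_all
  then show ?thesis
    unfolding g_def g'_def by simp
qed

lemma bracket_even_jacobi:
  assumes "x \<in> L 0" "y \<in> L i"
  shows "bracket x (bracket y z) = bracket (bracket x y) z + bracket y (bracket x z)"
  using super_jacobi[OF assms, of z] by (simp add: super_sign_def)

lemma bracket_even_skew:
  assumes "x \<in> L 0" "y \<in> L i"
  shows "bracket y x = - bracket x y"
  using super_skew[OF assms(2,1)] by (simp add: super_sign_def)

lemma bracket_odd_commute:
  assumes "x \<in> L 1" "y \<in> L 1"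
  shows "bracket y x = bracket x y"
  using super_skew[OF assms] by (simp add: super_sign_def)

text \<open>For odd \<open>x\<close> the sign in the super Jacobi identity is \<open>-1\<close>, so
  two equal terms add up. This relates the action of an odd vector to that of its even
  square.\<close>

lemma bracket_odd_square:
  assumes "x \<in> L 1"
  shows "bracket (bracket x x) z = scale 2 (bracket x (bracket x z))"
proof -
  have "bracket (bracket x x) z = bracket x (bracket x z) + bracket x (bracket x z)"
    using super_jacobi[OF assms assms, of z] by (simp add: super_sign_def eq_diff_eq)
  also have "\<dots> = scale 2 (bracket x (bracket x z))"
    by (metis one_add_one scale_left_distrib scale_one)
  finally show ?thesis .
qed

end

section \<open>The form, functionals on \<open>H\<close> and their representatives\<close>

context super_toral_triple
begin

abbreviation W where "W \<equiv> weight_space scale bracket H"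
abbreviation R where "R \<equiv> root_system scale bracket H"
abbreviation inner where "inner \<equiv> dual_form H form"
abbreviation rep where "rep \<equiv> dual_rep H form"
abbreviation P where "P \<equiv> dual_map H form ` H"

lemma form_simps [simp]:
  "form (x + x') y = form x y + form x' y"
  "form y (x + x') = form y x + form y x'"
  "form (scale c x) y = c * form x y"
  "form y (scale c x) = c * form y x"
  "form (x - x') y = form x y - form x' y"
proof -
  interpret l: Vector_Spaces.linear scale "(*)" "\<lambda>x. form x y"
    by (rule form_linear_left)
  interpret r: Vector_Spaces.linear scale "(*)" "\<lambda>x. form y x"
    by (rule form_linear_right)
  show "form (x + x') y = form x y + form x' y"
    "form y (x + x') = form y x + form y x'"
    "form (scale c x) y = c * form x y"
    "form y (scale c x) = c * form y x"
    "form (x - x') y = form x y - form x' y"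
    by (fact l.add r.add l.scale r.scale l.diff)+
qed

lemma form_commute_H: "h \<in> H \<Longrightarrow> h' \<in> H \<Longrightarrow> form h h' = form h' h"
  using form_supersymmetric[of h 0 h' 0] H_even by (auto simp: super_sign_def)

lemma dual_map_inj: "inj_on (dual_map H form) H"
proof
  fix h h' assume h: "h \<in> H" "h' \<in> H" "dual_map H form h = dual_map H form h'"
  have "form (h - h') x = 0" if "x \<in> H" for x
    using fun_cong[OF h(3), of x] that by (simp add: dual_map_def)
  then show "h = h'"
    using form_nondegenerate_H[of "h - h'"] subspace_diff[OF H_subspace] h by auto
qed

lemma rep_dual_map: "h \<in> H \<Longrightarrow> rep (dual_map H form h) = h"
  unfolding dual_rep_def using dual_map_inj by (intro the_equality) (auto dest: inj_onD)

lemma rep_in_H: "\<alpha> \<in> P \<Longrightarrow> rep \<alpha> \<in> H"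
  using rep_dual_map by auto

lemma dual_map_rep: "\<alpha> \<in> P \<Longrightarrow> dual_map H form (rep \<alpha>) = \<alpha>"
  using rep_dual_map by auto

lemma form_rep: "\<alpha> \<in> P \<Longrightarrow> h \<in> H \<Longrightarrow> form (rep \<alpha>) h = \<alpha> h"
  using dual_map_rep[of \<alpha>] by (metis dual_map_def)

lemma inner_eq: "\<beta> \<in> P \<Longrightarrow> \<alpha> \<in> P \<Longrightarrow> inner \<beta> \<alpha> = \<beta> (rep \<alpha>)"
  unfolding dual_form_def using form_rep rep_in_H by simp

lemma inner_commute: "\<beta> \<in> P \<Longrightarrow> \<alpha> \<in> P \<Longrightarrow> inner \<beta> \<alpha> = inner \<alpha> \<beta>"
  unfolding dual_form_def using form_commute_H rep_in_H by simp

lemma P_add_scale: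
  assumes "\<beta> \<in> P" "\<alpha> \<in> P"
  shows "(\<lambda>h. \<beta> h + k * \<alpha> h) \<in> P"
proof -
  obtain s t where st: "s \<in> H" "\<beta> = dual_map H form s" "t \<in> H" "\<alpha> = dual_map H form t"
    using assms by blast
  then have "(\<lambda>h. \<beta> h + k * \<alpha> h) = dual_map H form (s + scale k t)"
    by (auto simp: dual_map_def)
  moreover have "s + scale k t \<in> H"
    using st H_subspace subspace_add subspace_scale by blast
  ultimately show ?thesis by blast
qed

lemma P_zero: "(\<lambda>_. 0) \<in> P"
proof -
  \<comment> \<open>Writing zero as \<open>scale 0 0\<close> lets the scaling rule in
    \<open>form_simps\<close> produce the factor 0.\<close>
  have "dual_map H form (scale 0 0) = (\<lambda>_. 0)"
    by (simp only: dual_map_def form_simps mult_zero_left if_cancel)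
  moreover have "scale 0 0 \<in> H"
    using subspace_0[OF H_subspace] by simp
  ultimately show ?thesis
    using imageI[of "scale 0 0" H "dual_map H form"] by simp
qed

lemma P_scale: "\<alpha> \<in> P \<Longrightarrow> (\<lambda>h. k * \<alpha> h) \<in> P"
  using P_add_scale[OF P_zero, of \<alpha> k] by simp

lemma inner_add_scale:
  assumes "\<beta> \<in> P" "\<alpha> \<in> P" "\<gamma> \<in> P"
  shows "inner (\<lambda>h. \<beta> h + k * \<alpha> h) \<gamma> = inner \<beta> \<gamma> + k * inner \<alpha> \<gamma>"
    and "inner \<gamma> (\<lambda>h. \<beta> h + k * \<alpha> h) = inner \<gamma> \<beta> + k * inner \<gamma> \<alpha>"
proof -
  show "inner (\<lambda>h. \<beta> h + k * \<alpha> h) \<gamma> = inner \<beta> \<gamma> + k * inner \<alpha> \<gamma>"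
    using assms by (simp add: inner_eq P_add_scale)
  then show "inner \<gamma> (\<lambda>h. \<beta> h + k * \<alpha> h) = inner \<gamma> \<beta> + k * inner \<gamma> \<alpha>"
    using inner_commute[OF P_add_scale[OF assms(1,2)] assms(3), of k]
      inner_commute[OF assms(1,3)] inner_commute[OF assms(2,3)] by simp
qed

lemma inner_scale:
  assumes "\<alpha> \<in> P" "\<gamma> \<in> P"
  shows "inner (\<lambda>h. k * \<alpha> h) \<gamma> = k * inner \<alpha> \<gamma>"
    and "inner \<gamma> (\<lambda>h. k * \<alpha> h) = k * inner \<gamma> \<alpha>"
proof -
  show "inner (\<lambda>h. k * \<alpha> h) \<gamma> = k * inner \<alpha> \<gamma>"
    using assms by (simp add: inner_eq P_scale)
  then show "inner \<gamma> (\<lambda>h. k * \<alpha> h) = k * inner \<gamma> \<alpha>"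
    using inner_commute[OF P_scale[OF assms(1)] assms(2), of k] inner_commute[OF assms] by simp
qed

section \<open>Weight vectors and roots\<close>

lemma dual_space_add_scale:
  "\<beta> \<in> dual_space scale H \<Longrightarrow> \<alpha> \<in> dual_space scale H \<Longrightarrow>
    (\<lambda>h. \<beta> h + k * \<alpha> h) \<in> dual_space scale H"
  unfolding dual_space_def by (auto simp: algebra_simps)

lemma dual_space_scale:
  "\<alpha> \<in> dual_space scale H \<Longrightarrow> (\<lambda>h. k * \<alpha> h) \<in> dual_space scale H"
  unfolding dual_space_def by (auto simp: algebra_simps)

lemma root_dual_space: "\<alpha> \<in> R \<Longrightarrow> \<alpha> \<in> dual_space scale H"
  unfolding root_system_def by simp

lemma dual_space_apply_scale: "\<alpha> \<in> dual_space scale H \<Longrightarrow> h \<in> H \<Longrightarrow> \<alpha> (scale c h) = c * \<alpha> h"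
  unfolding dual_space_def by simp

lemma zero_in_W: "0 \<in> W \<alpha>"
  unfolding weight_space_def by simp

lemma W_scale: "x \<in> W \<alpha> \<Longrightarrow> scale c x \<in> W \<alpha>"
  unfolding weight_space_def by (simp add: scale_left_commute)

lemma rootI: "\<alpha> \<in> dual_space scale H \<Longrightarrow> x \<in> W \<alpha> \<Longrightarrow> x \<noteq> 0 \<Longrightarrow> \<alpha> \<in> R"
  unfolding root_system_def by auto

lemma rootE:
  assumes "\<alpha> \<in> R"
  obtains x where "x \<in> W \<alpha>" "x \<noteq> 0"
  using assms zero_in_W[of \<alpha>] unfolding root_system_def by auto

text \<open>Elements of \<open>H\<close> are even, so they act as derivations without signs and
  weights add. The weight \<open>\<gamma>\<close> is constrained only pointwise on \<open>H\<close>,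
  which lets each use present it in its own form.\<close>

lemma bracket_W:
  assumes "x \<in> L i" "x \<in> W \<alpha>" "y \<in> W \<beta>" "\<And>h. h \<in> H \<Longrightarrow> \<gamma> h = \<alpha> h + \<beta> h"
  shows "bracket x y \<in> W \<gamma>"
  using assms H_even
  by (auto simp: weight_space_def subset_iff bracket_even_jacobi[OF _ assms(1)] scale_left_distrib)

text \<open>Even elements preserve parity, so the eigenvector equation for \<open>a + b\<close>
  splits into its even and odd parts.\<close>

lemma W_parity_components:
  assumes "a \<in> L 0" "b \<in> L 1" "a + b \<in> W \<alpha>"
  shows "a \<in> W \<alpha> \<and> b \<in> W \<alpha>"
proof -
  have "bracket h a = scale (\<alpha> h) a \<and> bracket h b = scale (\<alpha> h) b" if "h \<in> H" for h
  proof (rule parity_decomposition_unique)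
    have h: "h \<in> L 0" using that H_even by auto
    show "bracket h a \<in> L 0" "bracket h b \<in> L 1"
      using bracket_grading[OF h assms(1)] bracket_grading[OF h assms(2)] by simp_all
    show "scale (\<alpha> h) a \<in> L 0" "scale (\<alpha> h) b \<in> L 1"
      using assms subspace_parity subspace_scale by blast+
    show "bracket h a + bracket h b = scale (\<alpha> h) a + scale (\<alpha> h) b"
      using assms(3) that by (simp add: weight_space_def scale_right_distrib)
  qed
  then show ?thesis
    unfolding weight_space_def by simp
qed

text \<open>Some parity component of a root vector is nonzero; this supplies the parity that
  \<open>root_pair\<close> asks for.\<close>

lemma root_graded:
  assumes "\<alpha> \<in> R"
  obtains i where "\<alpha> \<in> graded_root_system scale bracket L H i"
proof -
  obtain x where x: "x \<in> W \<alpha>" "x \<noteq> 0"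
    using assms by (rule rootE)
  obtain a b where ab: "a \<in> L 0" "b \<in> L 1" "x = a + b"
    by (rule parity_decomposition)
  have "a \<in> W \<alpha>" "b \<in> W \<alpha>"
    using W_parity_components ab x by blast+
  moreover have "a \<noteq> 0 \<or> b \<noteq> 0"
    using ab x by auto
  ultimately show ?thesis
    using that[of 0] that[of 1] ab root_dual_space[OF assms]
    unfolding graded_root_system_def by auto
qed

text \<open>Invariance leads to \<open>form x (bracket y h)\<close>, and \<open>bracket y h\<close>
  is a multiple of \<open>y\<close>.\<close>

lemma form_bracket_root_vectors:
  assumes "x \<in> L i" "y \<in> L i" "y \<in> W (\<lambda>h. - \<alpha> h)" "h \<in> H"
  shows "form (bracket x y) h = form x y * \<alpha> h"
proof -
  have "bracket y h = - bracket h y"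
    using bracket_even_skew assms H_even by blast
  also have "\<dots> = scale (\<alpha> h) y"
    using assms by (simp add: weight_space_def)
  finally show ?thesis
    by (simp add: form_invariant)
qed

text \<open>Both sides lie in \<open>H\<close>, where the form is nondegenerate, so it suffices to
  compare their pairings with \<open>H\<close>.\<close>

lemma bracket_root_vectors:
  assumes "x \<in> L i" "y \<in> L i" "y \<in> W (\<lambda>h. - \<alpha> h)" "bracket x y \<in> H" "\<alpha> \<in> P"
  shows "bracket x y = scale (form x y) (rep \<alpha>)"
proof -
  have "scale (form x y) (rep \<alpha>) \<in> H"
    using rep_in_H assms(5) H_subspace subspace_scale by blast
  moreover have "form (bracket x y - scale (form x y) (rep \<alpha>)) h = 0" if "h \<in> H" for h
    using form_bracket_root_vectors[OF assms(1-3) that] form_rep[OF assms(5) that] by simp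
  ultimately show ?thesis
    using form_nondegenerate_H[of "bracket x y - scale (form x y) (rep \<alpha>)"]
      subspace_diff[OF H_subspace] assms(4) by auto
qed

section \<open>Locally nilpotent sl2-triples\<close>

text \<open>The relations \<open>[h, e] = 2 e\<close> and \<open>[h, f] = - 2 f\<close> are
  contained in the weights of \<open>e\<close> and \<open>f\<close> together with
  \<open>\<gamma> h = 2\<close>. Local nilpotency takes the place of finite dimension.\<close>

definition sl2_triple :: "('v \<Rightarrow> 'f) \<Rightarrow> 'v \<Rightarrow> 'v \<Rightarrow> 'v \<Rightarrow> bool" where
  "sl2_triple \<gamma> e f h \<longleftrightarrow> \<gamma> \<in> dual_space scale H \<and>
     e \<in> L 0 \<inter> W \<gamma> \<and> f \<in> L 0 \<inter> W (\<lambda>h. - \<gamma> h) \<and> h \<in> H \<and> \<gamma> h = 2 \<and> bracket e f = h \<and>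
     (\<forall>y. \<exists>n. (bracket e ^^ n) y = 0) \<and> (\<forall>y. \<exists>n. (bracket f ^^ n) y = 0)"

text \<open>This carries results about lowering over to raising. The form
  \<open>scale (-1) h\<close> suits \<open>dual_space_apply_scale\<close>, which evaluates
  functionals at multiples.\<close>

lemma sl2_triple_swap:
  assumes "sl2_triple \<gamma> e f h"
  shows "sl2_triple (\<lambda>h. - \<gamma> h) f e (scale (-1) h)"
proof -
  have "bracket f e = - bracket e f"
    using assms bracket_even_skew[of e f 0] unfolding sl2_triple_def by auto
  then show ?thesis
    using assms dual_space_scale[of \<gamma> "-1"] subspace_scale[OF H_subspace, of h "-1"]
      dual_space_apply_scale[of \<gamma> h "-1"]
    unfolding sl2_triple_def by simp
qed

lemma funpow_bracket_W:
  assumes "x \<in> L i" "x \<in> W \<gamma>" "v \<in> W \<beta>"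
  shows "(bracket x ^^ k) v \<in> W (\<lambda>h. \<beta> h + of_nat k * \<gamma> h)"
proof (induction k)
  case 0
  then show ?case using assms by simp
next
  case (Suc k)
  then show ?case
    using bracket_W[OF assms(1,2) Suc] by (simp add: algebra_simps)
qed

text \<open>Each time \<open>e\<close> moves past an \<open>f\<close>, the commutator
  \<open>h\<close> contributes a weight \<open>\<beta> h - 2 i\<close>; the coefficient is the sum
  of these for \<open>i\<close> from 0 to \<open>j\<close>.\<close>

lemma sl2_raise_lower:
  assumes sl2: "sl2_triple \<gamma> e f h" and v: "v \<in> W \<beta>" "bracket e v = 0"
  shows "bracket e ((bracket f ^^ Suc j) v) =
    scale (of_nat (Suc j) * (\<beta> h - of_nat j)) ((bracket f ^^ j) v)"
proof -
  have ef: "bracket e (bracket f z) = bracket h z + bracket f (bracket e z)" for z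
    using sl2 bracket_even_jacobi[of e f 0 z] unfolding sl2_triple_def by auto
  have hw: "bracket h ((bracket f ^^ j) v) = scale (\<beta> h - 2 * of_nat j) ((bracket f ^^ j) v)" for j
    using sl2 funpow_bracket_W[of f 0 "\<lambda>h. - \<gamma> h" v \<beta> j] v
    unfolding sl2_triple_def weight_space_def by (auto simp: mult.commute)
  show ?thesis
  proof (induction j)
    case 0
    show ?case using ef hw[of 0] v by simp
  next
    case (Suc j)
    have "bracket e ((bracket f ^^ Suc (Suc j)) v) =
      scale (\<beta> h - 2 * of_nat (Suc j) + of_nat (Suc j) * (\<beta> h - of_nat j)) ((bracket f ^^ Suc j) v)"
      using ef[of "(bracket f ^^ Suc j) v"] hw[of "Suc j"] Suc
      by (simp add: scale_left_distrib)
    also have "\<beta> h - 2 * of_nat (Suc j) + of_nat (Suc j) * (\<beta> h - of_nat j) =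
        of_nat (Suc (Suc j)) * (\<beta> h - of_nat (Suc j))"
      by (simp add: algebra_simps)
    finally show ?case .
  qed
qed

text \<open>Let \<open>Suc N\<close> be the first power of \<open>f\<close> that kills
  \<open>v\<close>. Applying \<open>e\<close> there gives \<open>(N + 1) (\<beta> h - N)\<close>
  times a nonzero vector, and \<open>N + 1\<close> is nonzero in characteristic zero.\<close>

lemma sl2_highest_weight:
  assumes sl2: "sl2_triple \<gamma> e f h" and v: "v \<in> W \<beta>" "bracket e v = 0" "v \<noteq> 0"
  obtains N where "\<beta> h = of_nat N" "\<And>j. j \<le> N \<Longrightarrow> (bracket f ^^ j) v \<noteq> 0"
proof -
  define M where "M = (LEAST n. (bracket f ^^ n) v = 0)"
  have "\<exists>n. (bracket f ^^ n) v = 0"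
    using sl2 unfolding sl2_triple_def by blast
  then have M: "(bracket f ^^ M) v = 0"
    unfolding M_def by (rule LeastI_ex)
  have below: "(bracket f ^^ j) v \<noteq> 0" if "j < M" for j
    using not_less_Least that unfolding M_def by blast
  have "M \<noteq> 0"
    using M v by (auto intro: ccontr)
  then obtain N where N: "M = Suc N"
    using not0_implies_Suc by blast
  have "scale (of_nat (Suc N) * (\<beta> h - of_nat N)) ((bracket f ^^ N) v) = 0"
    using sl2_raise_lower[OF sl2 v(1,2), of N] M N by simp
  then have "\<beta> h = of_nat N"
    using below[of N] N by (simp del: of_nat_Suc)
  then show ?thesis
    using that below N by (simp add: less_Suc_eq_le)
qed

text \<open>Raising a root vector by \<open>e\<close> as long as possible gives a highest weight
  vector \<open>w\<close>; the powers of \<open>f\<close> then descend from \<open>w\<close> through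
  the string.\<close>

lemma sl2_root_string:
  assumes sl2: "sl2_triple \<gamma> e f h" and "\<beta> \<in> R"
  obtains n :: int where "\<beta> h = of_int n"
    "\<And>j. int j \<le> n \<Longrightarrow> (\<lambda>x. \<beta> x - of_nat j * \<gamma> x) \<in> R"
proof -
  obtain v where v: "v \<in> W \<beta>" "v \<noteq> 0"
    using \<open>\<beta> \<in> R\<close> by (rule rootE)
  define M where "M = (LEAST n. (bracket e ^^ n) v = 0)"
  have "\<exists>n. (bracket e ^^ n) v = 0"
    using sl2 unfolding sl2_triple_def by blast
  then have M: "(bracket e ^^ M) v = 0"
    unfolding M_def by (rule LeastI_ex)
  have "M \<noteq> 0"
    using M v by (auto intro: ccontr)
  then obtain k where k: "M = Suc k"
    using not0_implies_Suc by blast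
  define w where "w = (bracket e ^^ k) v"
  have w: "w \<noteq> 0" "bracket e w = 0" "w \<in> W (\<lambda>h. \<beta> h + of_nat k * \<gamma> h)"
  proof -
    show "w \<noteq> 0"
      using not_less_Least[of k "\<lambda>n. (bracket e ^^ n) v = 0"] k unfolding M_def w_def by simp
    show "bracket e w = 0"
      using M k unfolding w_def by simp
    show "w \<in> W (\<lambda>h. \<beta> h + of_nat k * \<gamma> h)"
      unfolding w_def using sl2 v by (intro funpow_bracket_W[of e 0]) (auto simp: sl2_triple_def)
  qed
  obtain N where N: "\<beta> h + of_nat k * \<gamma> h = of_nat N" "\<And>j. j \<le> N \<Longrightarrow> (bracket f ^^ j) w \<noteq> 0"
    using sl2_highest_weight[OF sl2 w(3,2,1)] by blast
  show ?thesis
  \<comment> \<open>Since \<open>\<gamma> h = 2\<close>, the weight \<open>N\<close> of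
    \<open>w\<close> exceeds \<open>\<beta> h\<close> by \<open>2 * k\<close>.\<close>
  proof (rule that[of "int N - 2 * int k"])
    show "\<beta> h = of_int (int N - 2 * int k)"
      using N(1) sl2 unfolding sl2_triple_def by (simp add: eq_diff_eq mult.commute)
    fix j assume j: "int j \<le> int N - 2 * int k"
    show "(\<lambda>x. \<beta> x - of_nat j * \<gamma> x) \<in> R"
    proof (rule rootI)
      show "(\<lambda>x. \<beta> x - of_nat j * \<gamma> x) \<in> dual_space scale H"
        using dual_space_add_scale[of \<beta> \<gamma> "- of_nat j"] root_dual_space[OF \<open>\<beta> \<in> R\<close>] sl2
        unfolding sl2_triple_def by simp
      \<comment> \<open>The first \<open>k\<close> lowerings return to weight \<open>\<beta>\<close>
        and \<open>j\<close> more reach the target; the bound on \<open>j\<close> gives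
        \<open>k + j \<le> N\<close>.\<close>
      show "(bracket f ^^ (k + j)) w \<noteq> 0"
        using N(2) j by simp
      have "(bracket f ^^ (k + j)) w \<in> W (\<lambda>x. \<beta> x + of_nat k * \<gamma> x + of_nat (k + j) * - \<gamma> x)"
        using sl2 w by (intro funpow_bracket_W[of f 0]) (auto simp: sl2_triple_def)
      then show "(bracket f ^^ (k + j)) w \<in> W (\<lambda>x. \<beta> x - of_nat j * \<gamma> x)"
        by (simp add: algebra_simps)
    qed
  qed
qed

text \<open>With \<open>n\<close> the integer \<open>\<beta> h\<close>, the reflection is step
  \<open>n\<close> of the descending string; for negative \<open>n\<close> the swapped triple
  supplies the string in the other direction.\<close>

lemma sl2_integral_reflection:
  assumes sl2: "sl2_triple \<gamma> e f h" and "\<beta> \<in> R"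
  shows "\<beta> h \<in> \<int>" and "(\<lambda>x. \<beta> x - \<beta> h * \<gamma> x) \<in> R"
proof -
  obtain n where n: "\<beta> h = of_int n" "\<And>j. int j \<le> n \<Longrightarrow> (\<lambda>x. \<beta> x - of_nat j * \<gamma> x) \<in> R"
    using sl2_root_string[OF assms] by blast
  show "\<beta> h \<in> \<int>"
    using n by simp
  show "(\<lambda>x. \<beta> x - \<beta> h * \<gamma> x) \<in> R"
  proof (cases "n \<ge> 0")
    case True
    then show ?thesis using n(1) n(2)[of "nat n"] by simp
  next
    case False
    obtain m where m: "\<beta> (scale (-1) h) = of_int m"
      "\<And>j. int j \<le> m \<Longrightarrow> (\<lambda>x. \<beta> x - of_nat j * - \<gamma> x) \<in> R"
      using sl2_root_string[OF sl2_triple_swap[OF sl2] \<open>\<beta> \<in> R\<close>] by blast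
    have "of_int m = (of_int (- n) :: 'f)"
      using m(1) n(1) dual_space_apply_scale[OF root_dual_space[OF \<open>\<beta> \<in> R\<close>], of h "-1"] sl2
      unfolding sl2_triple_def by simp
    then have "m = - n"
      by (simp only: of_int_eq_iff)
    then show ?thesis
      using False m(2)[of "nat (- n)"] n(1) by simp
  qed
qed

text \<open>A nonzero vector killed by \<open>f\<close> has highest weight for the swapped triple,
  so \<open>- n\<close> would be a natural number.\<close>

lemma sl2_lower_nonzero:
  assumes sl2: "sl2_triple \<gamma> e f h" and "\<beta> \<in> R" "v \<in> W \<beta>" "v \<noteq> 0" "\<beta> h = of_int n" "n > 0"
  shows "bracket f v \<noteq> 0"
proof
  assume "bracket f v = 0"
  then obtain N where "\<beta> (scale (-1) h) = of_nat N"
    using sl2_highest_weight[OF sl2_triple_swap[OF sl2]] assms by blast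
  then have "of_int (- n) = (of_int (int N) :: 'f)"
    using sl2 assms(5) dual_space_apply_scale[OF root_dual_space[OF \<open>\<beta> \<in> R\<close>], of h "-1"]
    unfolding sl2_triple_def by simp
  then show False
    using \<open>n > 0\<close> by (simp only: of_int_eq_iff)
qed

end

section \<open>Integrality and reflections for nonisotropic roots\<close>

context extended_affine_lie_superalgebra
begin

text \<open>Divided by \<open>form x y\<close>, the bracket of a root pair represents
  \<open>\<alpha>\<close> on \<open>H\<close>.\<close>

lemma root_in_P:
  assumes "\<alpha> \<in> R"
  shows "\<alpha> \<in> P"
proof (cases "\<alpha> = (\<lambda>_. 0)")
  case True
  then show ?thesis using P_zero by simp
next
  case False
  obtain i where i: "\<alpha> \<in> graded_root_system scale bracket L H i"
    using assms by (rule root_graded)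
  obtain x y where xy: "x \<in> L i" "y \<in> L i" "y \<in> W (\<lambda>h. - \<alpha> h)" "bracket x y \<noteq> 0" "bracket x y \<in> H"
    using root_pair[OF i False] by blast
  note eq = form_bracket_root_vectors[OF xy(1-3)]
  \<comment> \<open>Otherwise \<open>bracket x y\<close> would be orthogonal to \<open>H\<close>,
    hence zero.\<close>
  have "form x y \<noteq> 0"
    using form_nondegenerate_H[OF xy(5)] eq xy(4) by auto
  have "dual_map H form (scale (1 / form x y) (bracket x y)) = \<alpha>"
  proof
    fix h
    show "dual_map H form (scale (1 / form x y) (bracket x y)) h = \<alpha> h"
      using eq[of h] \<open>form x y \<noteq> 0\<close> root_dual_space[OF assms]
      by (auto simp: dual_map_def dual_space_def)
  qed
  then show ?thesis
    by (rule image_eqI[OF sym subspace_scale[OF H_subspace xy(5)]])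
qed

text \<open>Nonisotropy enters twice: it allows \<open>\<gamma>\<close> to be normalised to 2 on the
  bracket, and it makes \<open>e\<close> and \<open>f\<close> locally nilpotent, since
  \<open>\<gamma>\<close> and its negative are both nonisotropic roots.\<close>

lemma sl2_triple_of_pair:
  assumes ef: "e \<in> L 0 \<inter> W \<gamma>" "f \<in> L 0 \<inter> W (\<lambda>h. - \<gamma> h)" "bracket e f \<in> H" "bracket e f \<noteq> 0"
    and \<gamma>: "\<gamma> \<in> dual_space scale H" "\<gamma> \<in> P" "inner \<gamma> \<gamma> \<noteq> 0"
  obtains c where "sl2_triple \<gamma> e (scale c f) (scale c (bracket e f))"
    and "\<And>\<beta>. \<beta> \<in> R \<Longrightarrow> \<beta> (scale c (bracket e f)) = 2 * inner \<beta> \<gamma> / inner \<gamma> \<gamma>"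
proof -
  \<comment> \<open>\<open>bracket e f\<close> is \<open>form e f\<close> times
    \<open>rep \<gamma>\<close>, so this factor turns it into the coroot
    \<open>2 / inner \<gamma> \<gamma>\<close> times \<open>rep \<gamma>\<close>.\<close>
  define c where "c = 2 / (form e f * inner \<gamma> \<gamma>)"
  have eq: "bracket e f = scale (form e f) (rep \<gamma>)"
    using bracket_root_vectors[of e 0 f \<gamma>] ef \<gamma> by auto
  then have nz: "form e f \<noteq> 0"
    using ef by auto
  have ch: "scale c (bracket e f) = scale (2 / inner \<gamma> \<gamma>) (rep \<gamma>)"
    unfolding eq c_def using nz by simp
  have eval: "\<beta> (scale c (bracket e f)) = 2 * inner \<beta> \<gamma> / inner \<gamma> \<gamma>"
    if "\<beta> \<in> dual_space scale H" "\<beta> \<in> P" for \<beta>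
    using that dual_space_apply_scale[OF that(1) rep_in_H[OF \<gamma>(2)]] \<gamma>
    by (simp add: ch inner_eq)
  have neg: "(\<lambda>h. - \<gamma> h) \<in> R" "\<gamma> \<in> R"
    using ef \<gamma>(1) dual_space_scale[OF \<gamma>(1), of "-1"] by (auto intro: rootI)
  have "inner (\<lambda>h. - \<gamma> h) (\<lambda>h. - \<gamma> h) = inner \<gamma> \<gamma>"
    using inner_scale[of \<gamma> \<gamma> "-1"] inner_scale(1)[of \<gamma> "\<lambda>h. - \<gamma> h" "-1"] \<gamma> P_scale[of \<gamma> "-1"] by simp
  then have nil: "\<exists>n. (bracket (scale c f) ^^ n) y = 0" for y
    using ad_locally_nilpotent[of "\<lambda>h. - \<gamma> h" "scale c f" y] neg \<gamma> ef W_scale by auto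
  have "e \<in> L 0 \<inter> W \<gamma>" "scale c f \<in> L 0 \<inter> W (\<lambda>h. - \<gamma> h)"
    using ef W_scale subspace_scale[OF subspace_parity] by blast+
  moreover have "scale c (bracket e f) \<in> H"
    by (rule subspace_scale[OF H_subspace ef(3)])
  moreover have "\<gamma> (scale c (bracket e f)) = 2"
    using eval[OF \<gamma>(1,2)] \<gamma>(3) by simp
  moreover have "\<exists>n. (bracket e ^^ n) y = 0" for y
    using ad_locally_nilpotent[OF neg(2) \<gamma>(3)] ef by blast
  ultimately have "sl2_triple \<gamma> e (scale c f) (scale c (bracket e f))"
    unfolding sl2_triple_def using \<gamma>(1) nil by (intro conjI allI) simp_all
  then show ?thesis
    using that eval root_dual_space root_in_P by blast
qed

text \<open>
  For an odd root \<open>\<alpha>\<close> with root vectors \<open>x\<close> and \<open>y\<close>, the squares \<open>[x, x]\<close> and \<open>[y, y]\<close> give an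
  sl2-triple for \<open>2\<alpha>\<close>, so the bracket with \<open>[y, y]\<close>, hence also with \<open>y\<close>, is injective on
  weight spaces of positive weight.
\<close>

lemma cartan_integer_reflection_step:
  assumes "\<alpha> \<in> R" "inner \<alpha> \<alpha> \<noteq> 0" "\<beta> \<in> R"
  obtains n :: int where "2 * inner \<beta> \<alpha> / inner \<alpha> \<alpha> = of_int n"
    and "(\<lambda>x. \<beta> x - of_int n * \<alpha> x) \<in> R"
    and "n > 0 \<Longrightarrow> (\<lambda>x. \<beta> x - \<alpha> x) \<in> R"
proof -
  have P: "\<alpha> \<in> P" "\<beta> \<in> P" and D: "\<alpha> \<in> dual_space scale H" "\<beta> \<in> dual_space scale H"
    using assms root_in_P root_dual_space by auto
  have D_step: "(\<lambda>x. \<beta> x - \<alpha> x) \<in> dual_space scale H"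
    using dual_space_add_scale[OF D(2,1), of "-1"] by simp
  have "\<alpha> \<noteq> (\<lambda>_. 0)"
    using assms(2) inner_eq[OF P(1) P(1)] by auto
  obtain i where i: "\<alpha> \<in> graded_root_system scale bracket L H i"
    using assms(1) by (rule root_graded)
  obtain x y where x: "x \<in> L i" "x \<in> W \<alpha>" and y: "y \<in> L i" "y \<in> W (\<lambda>h. - \<alpha> h)"
    and xy: "bracket x y \<noteq> 0" "bracket x y \<in> H"
    using root_pair[OF i \<open>\<alpha> \<noteq> (\<lambda>_. 0)\<close>] by blast
  obtain v where v: "v \<in> W \<beta>" "v \<noteq> 0"
    using \<open>\<beta> \<in> R\<close> by (rule rootE)
  have yv: "bracket y v \<in> W (\<lambda>x. \<beta> x - \<alpha> x)"
    using bracket_W[OF y v(1)] by simp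
  consider "i = 0" | "i = 1"
    by (cases i)
  then show ?thesis
  proof cases
    case 1
    obtain c where c: "sl2_triple \<alpha> x (scale c y) (scale c (bracket x y))"
      "\<beta> (scale c (bracket x y)) = 2 * inner \<beta> \<alpha> / inner \<alpha> \<alpha>"
      using sl2_triple_of_pair[of x \<alpha> y] x y xy 1 D P assms by auto
    obtain n where n: "2 * inner \<beta> \<alpha> / inner \<alpha> \<alpha> = of_int n"
      using sl2_integral_reflection(1)[OF c(1) \<open>\<beta> \<in> R\<close>] c(2) by (auto elim: Ints_cases)
    show ?thesis
    proof (rule that[OF n])
      show "(\<lambda>x. \<beta> x - of_int n * \<alpha> x) \<in> R"
        using sl2_integral_reflection(2)[OF c(1) \<open>\<beta> \<in> R\<close>] c(2) n by simp
      assume "n > 0"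
      then have "bracket y v \<noteq> 0"
        using sl2_lower_nonzero[OF c(1) \<open>\<beta> \<in> R\<close> v, of n] c(2) n by auto
      then show "(\<lambda>x. \<beta> x - \<alpha> x) \<in> R"
        by (rule rootI[OF D_step yv])
    qed
  next
    case 2
    define \<gamma> where "\<gamma> = (\<lambda>h. 2 * \<alpha> h)"
    define e where "e = bracket x x"
    define f where "f = bracket y y"
    have \<gamma>: "\<gamma> \<in> P" "\<gamma> \<in> dual_space scale H"
      unfolding \<gamma>_def using P D P_scale dual_space_scale by auto
    have inner_\<gamma>: "inner \<beta>' \<gamma> = 2 * inner \<beta>' \<alpha>" if "\<beta>' \<in> P" for \<beta>'
      unfolding \<gamma>_def using inner_scale(2) that P by simp
    then have inner_\<gamma>\<gamma>: "inner \<gamma> \<gamma> = 4 * inner \<alpha> \<alpha>"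
      using inner_scale(1)[OF P(1) P(1), of 2] \<gamma>(1) by (simp add: \<gamma>_def)
    have e: "e \<in> L 0 \<inter> W \<gamma>" and f: "f \<in> L 0 \<inter> W (\<lambda>h. - \<gamma> h)"
      using bracket_grading[OF x(1) x(1)] bracket_grading[OF y(1) y(1)]
        bracket_W[OF x x(2), of \<gamma>] bracket_W[OF y y(2), of "\<lambda>h. - \<gamma> h"] 2
      by (simp_all add: e_def f_def \<gamma>_def)
    have "form x y \<noteq> 0"
      using xy(1) bracket_root_vectors[OF x(1) y xy(2) P(1)] by auto
    \<comment> \<open>The value is \<open>form x y * inner \<alpha> \<alpha>\<close>; it reappears
      as a factor of \<open>bracket e f\<close> and keeps that from vanishing.\<close>
    then have \<alpha>h: "\<alpha> (bracket x y) \<noteq> 0"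
      using bracket_root_vectors[OF x(1) y xy(2) P(1)] assms(2)
        dual_space_apply_scale[OF D(1) rep_in_H[OF P(1)]] inner_eq[OF P(1) P(1)] by simp
    have "bracket x (bracket x y) = - scale (\<alpha> (bracket x y)) x"
      using bracket_even_skew[of "bracket x y" x i] x xy H_even
      by (auto simp: weight_space_def)
    then have ey: "bracket e y = - scale (2 * \<alpha> (bracket x y)) x"
      unfolding e_def using bracket_odd_square[of x y] x 2 by simp
    \<comment> \<open>The even element \<open>e\<close> acts as a derivation on
      \<open>[y, y]\<close>. Both terms are the same multiple of \<open>bracket x y\<close>, because
      the bracket of odd vectors is symmetric.\<close>
    have "bracket e f = bracket (bracket e y) y + bracket y (bracket e y)"
      unfolding f_def using bracket_even_jacobi[of e y i y] e y by auto
    also have "\<dots> = - scale (2 * \<alpha> (bracket x y)) (bracket x y) - scale (2 * \<alpha> (bracket x y)) (bracket x y)"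
      using bracket_odd_commute[of x y] x y 2 by (simp add: ey)
    also have "\<dots> = scale (- 4 * \<alpha> (bracket x y)) (bracket x y)"
      by (simp flip: scale_minus_left scale_left_diff_distrib)
    finally have ef: "bracket e f = scale (- 4 * \<alpha> (bracket x y)) (bracket x y)" .
    then have "bracket e f \<noteq> 0"
      using xy \<alpha>h by simp
    moreover have "bracket e f \<in> H"
      unfolding ef by (rule subspace_scale[OF H_subspace xy(2)])
    ultimately obtain c where sl2: "sl2_triple \<gamma> e (scale c f) (scale c (bracket e f))"
      and "\<beta> (scale c (bracket e f)) = 2 * inner \<beta> \<gamma> / inner \<gamma> \<gamma>"
      using sl2_triple_of_pair[OF e f] \<gamma> inner_\<gamma>\<gamma> assms by auto
    \<comment> \<open>Doubling the root halves the Cartan integer. Integrality for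
      \<open>\<gamma>\<close> therefore makes the Cartan integer for \<open>\<alpha>\<close> an even
      number \<open>2 * n\<close>.\<close>
    then have eval: "\<beta> (scale c (bracket e f)) = inner \<beta> \<alpha> / inner \<alpha> \<alpha>"
      by (simp add: inner_\<gamma>\<gamma> inner_\<gamma> P)
    obtain n where n: "inner \<beta> \<alpha> / inner \<alpha> \<alpha> = of_int n"
      using sl2_integral_reflection(1)[OF sl2 \<open>\<beta> \<in> R\<close>] eval by (auto elim: Ints_cases)
    show ?thesis
    proof (rule that[of "2 * n"])
      show "2 * inner \<beta> \<alpha> / inner \<alpha> \<alpha> = of_int (2 * n)"
        by (simp flip: n)
      \<comment> \<open>Subtracting \<open>n\<close> times \<open>\<gamma>\<close> is subtracting
        \<open>2 * n\<close> times \<open>\<alpha>\<close>, so both give the same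
        reflection.\<close>
      show "(\<lambda>x. \<beta> x - of_int (2 * n) * \<alpha> x) \<in> R"
        using sl2_integral_reflection(2)[OF sl2 \<open>\<beta> \<in> R\<close>]
        by (simp add: eval n \<gamma>_def mult.left_commute mult.assoc)
      assume "2 * n > 0"
      then have "bracket f v \<noteq> 0"
        using sl2_lower_nonzero[OF sl2 \<open>\<beta> \<in> R\<close> v, of n] eval n by auto
      then have "bracket y v \<noteq> 0"
        unfolding f_def using bracket_odd_square[of y v] y 2 by auto
      then show "(\<lambda>x. \<beta> x - \<alpha> x) \<in> R"
        by (rule rootI[OF D_step yv])
    qed
  qed
qed

section \<open>Multiples of roots and root strings\<close>

text \<open>For nonzero \<open>k\<close>, integrality of each of the two roots against the other
  makes \<open>2 k\<close> and \<open>2 / k\<close> integers with product 4.\<close>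

lemma multiple_root:
  assumes "\<alpha> \<in> R" "inner \<alpha> \<alpha> \<noteq> 0" "(\<lambda>h. k * \<alpha> h) \<in> R"
  shows "k \<in> {0, 1, -1, 2, -2, 1/2, -1/2}"
proof (cases "k = 0")
  case False
  let ?\<beta> = "\<lambda>h. k * \<alpha> h"
  have P: "\<alpha> \<in> P" "?\<beta> \<in> P"
    using assms root_in_P by auto
  have inner: "inner ?\<beta> \<alpha> = k * inner \<alpha> \<alpha>" "inner \<alpha> ?\<beta> = k * inner \<alpha> \<alpha>"
    "inner ?\<beta> ?\<beta> = k * (k * inner \<alpha> \<alpha>)"
    using inner_scale[OF P(1) P(1)] inner_scale(1)[OF P(1) P(2)] by simp_all
  obtain m where m: "2 * inner ?\<beta> \<alpha> / inner \<alpha> \<alpha> = of_int m"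
    using cartan_integer_reflection_step[OF assms] by blast
  have "inner ?\<beta> ?\<beta> \<noteq> 0"
    using inner False assms by simp
  then obtain m' where m': "2 * inner \<alpha> ?\<beta> / inner ?\<beta> ?\<beta> = of_int m'"
    using cartan_integer_reflection_step[OF assms(3) _ assms(1)] by blast
  have km: "2 * k = of_int m" "2 / k = of_int m'"
    using m m' inner assms(2) False by simp_all
  have "of_int (m * m') = (2 * k) * (2 / k)"
    using km by simp
  also have "\<dots> = of_int 4"
    using False by simp
  finally have "m * m' = 4"
    by (simp only: of_int_eq_iff)
  then have "m dvd 4"
    by (metis dvd_triv_left)
  then have "\<bar>m\<bar> \<le> 4"
    using dvd_imp_le_int[of 4 m] by simp
  then have "m = -4 \<or> m = -3 \<or> m = -2 \<or> m = -1 \<or> m = 0 \<or> m = 1 \<or> m = 2 \<or> m = 3 \<or> m = 4"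
    by linarith
  then have "m \<in> {-4, -2, -1, 1, 2, 4}"
    using \<open>m dvd 4\<close> by auto
  moreover have k: "k = of_int m / 2"
    by (simp flip: km(1))
  ultimately show ?thesis
    unfolding k by auto
qed simp

text \<open>
  If a root string had infinitely many members \<open>\<beta> + n \<alpha>\<close>, the integers
  \<open>2 (\<alpha>, \<beta> + n \<alpha>) / (\<beta> + n \<alpha>, \<beta> + n \<alpha>)\<close> would tend to \<open>0\<close> without vanishing.
\<close>

lemma root_string_bounded:
  assumes "\<alpha> \<in> R" "inner \<alpha> \<alpha> \<noteq> 0" "\<beta> \<in> R"
  shows "\<exists>u. \<forall>k\<in>{k::int. (\<lambda>h. \<beta> h + of_int k * \<alpha> h) \<in> R}. k \<le> u"
proof -
  have P: "\<alpha> \<in> P" "\<beta> \<in> P"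
    using assms root_in_P by auto
  obtain A where A: "2 * inner \<beta> \<alpha> / inner \<alpha> \<alpha> = of_int A"
    using cartan_integer_reflection_step[OF assms] by blast
  then have A': "2 * inner \<beta> \<alpha> = of_int A * inner \<alpha> \<alpha>"
    using assms(2) by (simp add: field_simps)
  \<comment> \<open>Divided by \<open>inner \<alpha> \<alpha>\<close>, the norm of the member at
    \<open>n\<close> becomes \<open>b + n A + n^2\<close>, the denominator in
    \<open>integral_quotients_bounded\<close>.\<close>
  define b where "b = inner \<beta> \<beta> / inner \<alpha> \<alpha>"
  have b: "inner \<beta> \<beta> = b * inner \<alpha> \<alpha>"
    unfolding b_def using assms(2) by simp
  show ?thesis
  proof (rule integral_quotients_bounded[of _ b A])
    fix n :: int
    let ?\<delta> = "\<lambda>h. \<beta> h + of_int n * \<alpha> h" and ?d = "b + of_int (n * A + n ^ 2)"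
    assume "n \<in> {k. (\<lambda>h. \<beta> h + of_int k * \<alpha> h) \<in> R}" and nz: "?d \<noteq> 0"
    then have \<delta>: "?\<delta> \<in> R"
      by simp
    have \<delta>P: "?\<delta> \<in> P"
      using root_in_P[OF \<delta>] .
    have "2 * inner \<alpha> ?\<delta> = 2 * inner \<beta> \<alpha> + 2 * (of_int n * inner \<alpha> \<alpha>)"
      using inner_add_scale(2)[OF P(2) P(1) P(1)] inner_commute[OF P(1) P(2)] by simp
    also have "\<dots> = of_int (A + 2 * n) * inner \<alpha> \<alpha>"
      unfolding A' by (simp add: algebra_simps)
    finally have inner\<alpha>: "2 * inner \<alpha> ?\<delta> = of_int (A + 2 * n) * inner \<alpha> \<alpha>" .
    have "inner ?\<delta> ?\<delta> = inner \<beta> \<beta> + of_int n * (2 * inner \<beta> \<alpha>) + of_int n * of_int n * inner \<alpha> \<alpha>"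
      using inner_add_scale(1)[OF P(2) P(1) \<delta>P] inner_add_scale(2)[OF P(2) P(1) P(2)]
        inner_add_scale(2)[OF P(2) P(1) P(1)] inner_commute[OF P(1) P(2)]
      by (simp add: algebra_simps)
    also have "\<dots> = ?d * inner \<alpha> \<alpha>"
      unfolding A' b by (simp add: algebra_simps power2_eq_square)
    finally have inner\<delta>: "inner ?\<delta> ?\<delta> = ?d * inner \<alpha> \<alpha>" .
    have "inner ?\<delta> ?\<delta> \<noteq> 0"
      unfolding inner\<delta> using nz assms(2) by (simp del: of_int_add)
    \<comment> \<open>The roles are exchanged: the string member now serves as the nonisotropic root
      and \<open>\<alpha>\<close> is tested against it.\<close>
    then obtain m where "2 * inner \<alpha> ?\<delta> / inner ?\<delta> ?\<delta> = of_int m"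
      using cartan_integer_reflection_step[OF \<delta> _ assms(1)] by blast
    then have "of_int (A + 2 * n) / ?d = of_int m"
      unfolding inner\<alpha> inner\<delta> using assms(2) by (simp del: of_int_add)
    then have "of_int m * ?d = of_int (A + 2 * n)"
      using nz by (simp only: nonzero_divide_eq_eq[OF nz])
    then show "\<exists>m::int. of_int m * ?d = of_int (A + 2 * n)"
      by blast
  qed
qed

text \<open>The member at \<open>k\<close> has Cartan integer \<open>n + 2 * k\<close>, so its
  reflection is the member at \<open>- n - k\<close>, and a step down is possible when
  \<open>n + 2 * k > 0\<close>. With boundedness these are the hypotheses of
  \<open>symmetric_string_eq_interval\<close>.\<close>

lemma root_string:
  assumes "\<alpha> \<in> R" "inner \<alpha> \<alpha> \<noteq> 0" "\<beta> \<in> R"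
  shows "\<exists>p q :: nat. of_nat p - of_nat q = 2 * inner \<beta> \<alpha> / inner \<alpha> \<alpha> \<and>
    {k::int. (\<lambda>h. \<beta> h + of_int k * \<alpha> h) \<in> R} = {- int p..int q}"
proof -
  have P: "\<alpha> \<in> P" "\<beta> \<in> P"
    using assms root_in_P by auto
  obtain n where n: "2 * inner \<beta> \<alpha> / inner \<alpha> \<alpha> = of_int n"
    using cartan_integer_reflection_step[OF assms] by blast
  let ?S = "{k::int. (\<lambda>h. \<beta> h + of_int k * \<alpha> h) \<in> R}"
  obtain u where u: "\<And>k. k \<in> ?S \<Longrightarrow> k \<le> u"
    using root_string_bounded[OF assms] by blast
  have string: "- n - k \<in> ?S \<and> (n + 2 * k > 0 \<longrightarrow> k - 1 \<in> ?S)" if "k \<in> ?S" for k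
  proof -
    let ?\<delta> = "\<lambda>h. \<beta> h + of_int k * \<alpha> h"
    have "?\<delta> \<in> R" using that by simp
    then obtain m where m: "2 * inner ?\<delta> \<alpha> / inner \<alpha> \<alpha> = of_int m"
      "(\<lambda>x. ?\<delta> x - of_int m * \<alpha> x) \<in> R" "m > 0 \<Longrightarrow> (\<lambda>x. ?\<delta> x - \<alpha> x) \<in> R"
      using cartan_integer_reflection_step[OF assms(1,2)] by blast
    have "2 * inner ?\<delta> \<alpha> / inner \<alpha> \<alpha> = 2 * inner \<beta> \<alpha> / inner \<alpha> \<alpha> + 2 * of_int k"
      using inner_add_scale(1)[OF P(2) P(1) P(1)] assms(2) by (simp add: field_simps)
    then have "of_int m = (of_int (n + 2 * k) :: 'f)"
      using m(1) n by simp
    then have "m = n + 2 * k"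
      by (simp only: of_int_eq_iff)
    then show ?thesis
      using m(2,3) by (auto simp: algebra_simps)
  qed
  have "0 \<in> ?S"
    using assms(3) by simp
  then obtain p q :: nat where pq: "int p - int q = n" "?S = {- int p..int q}"
    using symmetric_string_eq_interval[of ?S u n] u string by blast
  have "of_nat p - of_nat q = (of_int n :: 'f)"
    using arg_cong[OF pq(1), of "of_int :: int \<Rightarrow> 'f"] by simp
  then show ?thesis
    using pq(2) n by auto
qed

end

theorem proposition3p8:
  fixes scale :: "'f::field_char_0 \<Rightarrow> 'v::ab_group_add \<Rightarrow> 'v"
    and bracket :: "'v \<Rightarrow> 'v \<Rightarrow> 'v"
    and L :: "bit \<Rightarrow> 'v set"
    and H :: "'v set"
    and form :: "'v \<Rightarrow> 'v \<Rightarrow> 'f"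
    and \<alpha> \<beta> :: "'v \<Rightarrow> 'f"
  assumes "extended_affine_lie_superalgebra scale bracket L H form"
    and "\<alpha> \<in> root_system scale bracket H"
    and "\<beta> \<in> root_system scale bracket H"
    and "dual_form H form \<alpha> \<alpha> \<noteq> 0"
  shows "(2 * dual_form H form \<beta> \<alpha> / dual_form H form \<alpha> \<alpha> \<in> \<int> \<and>
          (\<forall>k::'f. (\<lambda>h. k * \<alpha> h) \<in> root_system scale bracket H \<longrightarrow>
             k \<in> {0, 1, -1, 2, -2, 1/2, -1/2})) \<and>
         root_reflection H form \<alpha> \<beta> \<in> root_system scale bracket H \<and>
         (\<exists>p q :: nat.
            of_nat p - of_nat q = 2 * dual_form H form \<beta> \<alpha> / dual_form H form \<alpha> \<alpha> \<and>
            {k::int. (\<lambda>h. \<beta> h + of_int k * \<alpha> h) \<in> root_system scale bracket H} = {- int p..int q})"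
proof -
  interpret extended_affine_lie_superalgebra scale bracket L H form
    by (rule assms(1))
  obtain n :: int where n: "2 * inner \<beta> \<alpha> / inner \<alpha> \<alpha> = of_int n"
    "(\<lambda>x. \<beta> x - of_int n * \<alpha> x) \<in> R"
    using cartan_integer_reflection_step[OF assms(2,4,3)] by blast
  \<comment> \<open>The reflection is written with \<open>inner \<alpha> \<beta>\<close> and the
    Cartan integer with \<open>inner \<beta> \<alpha>\<close>, hence the appeal to symmetry.\<close>
  have "root_reflection H form \<alpha> \<beta> \<in> R"
    unfolding root_reflection_def
    using n inner_commute[OF root_in_P[OF assms(3)] root_in_P[OF assms(2)]] by simp
  moreover have "2 * inner \<beta> \<alpha> / inner \<alpha> \<alpha> \<in> \<int>"
    using n(1) by simp
  ultimately show ?thesis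
    using multiple_root[OF assms(2,4)] root_string[OF assms(2,4,3)] by blast
qed

end
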